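(* $P\in T$.
   Context: Let $D$ be a positive integer and let $Q_D$ be the $D$-cube: the graph with vertex set $X=\{0,1\}^D$, two vertices being adjacent iff they differ in exactly one coordinate; $\partial$ denotes path-length distance. $\mathrm{Mat}_X(\mathbb{C})$ is the algebra of complex matrices with rows and columns indexed by $X$. Write $\mathbf{i}^2=-1$. Let $A$ be the adjacency matrix of $Q_D$. Fix $x=(0,0,\ldots,0)\in X$. Let $A^*$ be the diagonal matrix in $\mathrm{Mat}_X(\mathbb{C})$ with $(y,y)$-entry $D-2\partial(x,y)$ for $y\in X$ (the dual adjacency matrix). Let $T$ be the subalgebra of $\mathrm{Mat}_X(\mathbb{C})$ generated by $A$ and $A^*$ (the Terwilliger algebra). Let $P_1$ be the matrix with rows and columns indexed by $\{0,1\}$, with $(0,0)$-entry $1$, $(0,1)$-entry $1$, $(1,0)$-entry $-\mathbf{i}$, and $(1,1)$-entry $\mathbf{i}$. Let $P=P_1^{\otimes D}\in\mathrm{Mat}_X(\mathbb{C})$ be the $D$-fold Kronecker power, i.e. for $y=(y_1,\ldots,y_D)$ and $z=(z_1,\ldots,z_D)$ in $X$, $P_{yz}=\prod_{k=1}^D (P_1)_{y_kz_k}$. *)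

theory Defs
  imports "HOL-Analysis.Analysis" "HOL-Library.Numeral_Type"
begin

(* The type 2 has exactly the elements 0 and 1, so the vertex set {0,1}^D is the type 2^'d,
   where 'd is an arbitrary finite nonempty type with CARD('d) = D.  Matrices M in Mat_X(C) have
   the type complex^(2^'d)^(2^'d), with (y,z)-entry M $ y $ z. *)

definition cube_adj :: "2 ^ 'd::finite \<Rightarrow> 2 ^ 'd \<Rightarrow> bool" where
  "cube_adj y z \<longleftrightarrow> (\<exists>!k. y $ k \<noteq> z $ k)"

(* Path-length distance; LEAST is well defined because the cube is connected. *)
definition cube_dist :: "2 ^ 'd::finite \<Rightarrow> 2 ^ 'd \<Rightarrow> nat" where
  "cube_dist y z = (LEAST n. (cube_adj ^^ n) y z)"

definition cube_adjacency_matrix :: "complex ^ (2 ^ 'd::finite) ^ (2 ^ 'd)" where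
  "cube_adjacency_matrix = (\<chi> y z. if cube_adj y z then 1 else 0)"

definition cube_dual_adjacency_matrix ::
    "2 ^ 'd::finite \<Rightarrow> complex ^ (2 ^ 'd) ^ (2 ^ 'd)" where
  "cube_dual_adjacency_matrix x =
     (\<chi> y z. if y = z then of_nat CARD('d) - 2 * of_nat (cube_dist x y) else 0)"

(* Subalgebras contain the identity matrix; this is the standard convention for Terwilliger
   algebras.  It matters: for even D, every element of the non-unital algebra generated by
   the two matrices below vanishes on their (nonzero) common kernel. *)
definition matrix_subalgebra :: "(complex ^ 'n::finite ^ 'n) set \<Rightarrow> bool" where
  "matrix_subalgebra S \<longleftrightarrow>
     mat 1 \<in> S \<and>
     (\<forall>M\<in>S. \<forall>N\<in>S. M + N \<in> S) \<and>
     (\<forall>c. \<forall>M\<in>S. (\<chi> i j. c * M $ i $ j) \<in> S) \<and>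
     (\<forall>M\<in>S. \<forall>N\<in>S. M ** N \<in> S)"

definition cube_terwilliger_algebra ::
    "2 ^ 'd::finite \<Rightarrow> (complex ^ (2 ^ 'd) ^ (2 ^ 'd)) set" where
  "cube_terwilliger_algebra x =
     matrix_subalgebra hull {cube_adjacency_matrix, cube_dual_adjacency_matrix x}"

definition P1 :: "complex ^ 2 ^ 2" where
  "P1 = (\<chi> a b. if a = 0 then 1 else if b = 0 then - \<i> else \<i>)"

(* The Kronecker power of P1 with one tensor factor for each coordinate. *)
definition cube_P :: "complex ^ (2 ^ 'd::finite) ^ (2 ^ 'd)" where
  "cube_P = (\<chi> y z. \<Prod>k\<in>UNIV. P1 $ (y $ k) $ (z $ k))"

end

theory Submission
  imports Defs
begin

text \<open>
  The matrix \<open>P1\<close> is the product of \<open>I - \<i> X\<close>, where \<open>X\<close> swaps the two basis vectors, and the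
  diagonal matrix with entries \<open>1, \<i>\<close>.  Taking Kronecker powers, \<open>P\<close> is the product of
  \<open>\<Sum>j. (-\<i>)^j A\<^sub>j\<close>, where \<open>A\<^sub>j\<close> is the distance-\<open>j\<close> matrix of the cube, and the diagonal matrix
  with \<open>(z,z)\<close>-entry \<open>\<i>\<close> to the power \<open>\<partial>(0,z)\<close>.  The three-term recurrence makes each \<open>A\<^sub>j\<close> a
  polynomial in \<open>A\<close>, and since the weight of \<open>z\<close> is a function of the \<open>(z,z)\<close>-entry of \<open>A\<^sup>*\<close>,
  interpolation makes the diagonal factor a polynomial in \<open>A\<^sup>*\<close>.
\<close>

lemma bit_cases: "(a::2) = 0 \<or> a = 1"
  using exhaust_2[of a] by auto

lemma bit_neq_trans: "(a::2) \<noteq> b \<Longrightarrow> b \<noteq> c \<Longrightarrow> a = c"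
  using bit_cases[of a] bit_cases[of b] bit_cases[of c] by auto

lemma prod_if_one_eq_power_card:
  fixes c :: "'a::comm_monoid_mult"
  assumes "finite A"
  shows "(\<Prod>k\<in>A. if Q k then c else 1) = c ^ card {k\<in>A. Q k}"
  using assms by (simp add: prod.inter_filter[symmetric])

section \<open>Hamming distance\<close>

definition hamming :: "2 ^ 'd::finite \<Rightarrow> 2 ^ 'd \<Rightarrow> nat" where
  "hamming y z = card {k. y $ k \<noteq> z $ k}"

text \<open>Addition in the type \<open>2\<close> is modulo 2, so adding 1 swaps the two values of a
  coordinate.\<close>

definition flip :: "2 ^ 'd::finite \<Rightarrow> 'd \<Rightarrow> 2 ^ 'd" where
  "flip y k = (\<chi> i. if i = k then y $ i + 1 else y $ i)"

lemma flip_nth: "flip y k $ i = (if i = k then y $ i + 1 else y $ i)"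
  by (simp add: flip_def)

lemma flip_nth_neq_iff: "flip y k $ i \<noteq> y $ i \<longleftrightarrow> i = k"
  by (simp add: flip_nth)

lemma inj_flip: "inj (flip y)"
  by (metis flip_nth_neq_iff injI)

lemma cube_adj_iff_flip: "cube_adj y u \<longleftrightarrow> u \<in> range (flip y)"
proof
  assume "cube_adj y u"
  then obtain k where k: "y $ k \<noteq> u $ k" and uniq: "\<And>i. y $ i \<noteq> u $ i \<Longrightarrow> i = k"
    unfolding cube_adj_def by blast
  have "u $ i = flip y k $ i" for i
  proof (cases "i = k")
    case True
    then show ?thesis
      using k flip_nth_neq_iff[of y k k] bit_neq_trans[of "u $ k" "y $ k" "flip y k $ k"] by metis
  next
    case False
    then have "y $ i = u $ i"
      using uniq by blast
    with False show ?thesis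
      by (simp add: flip_nth)
  qed
  then show "u \<in> range (flip y)"
    by (metis rangeI vec_eq_iff)
next
  assume "u \<in> range (flip y)"
  then show "cube_adj y u"
    unfolding cube_adj_def by (metis (full_types) flip_nth_neq_iff rangeE)
qed

text \<open>The neighbours of \<open>y\<close> are its flips, and different coordinates give
  different flips. This turns a row of a product with the adjacency matrix into a sum over
  coordinates.\<close>

lemma sum_cube_adj:
  fixes f :: "2 ^ 'd::finite \<Rightarrow> 'a::comm_monoid_add"
  shows "(\<Sum>u\<in>UNIV. if cube_adj y u then f u else 0) = (\<Sum>k\<in>UNIV. f (flip y k))"
proof -
  have "(\<Sum>u\<in>UNIV. if cube_adj y u then f u else 0) = sum f (range (flip y))"
    by (simp add: cube_adj_iff_flip sum.If_cases)
  also have "\<dots> = (\<Sum>k\<in>UNIV. f (flip y k))"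
    by (simp add: sum.reindex[OF inj_flip])
  finally show ?thesis .
qed

lemma hamming_flip_differ:
  assumes "y $ k \<noteq> z $ k"
  shows "hamming y z = Suc (hamming (flip y k) z)"
proof -
  have "flip y k $ k = z $ k"
    using assms flip_nth_neq_iff[of y k k] bit_neq_trans by metis
  then have "{i. y $ i \<noteq> z $ i} = insert k {i. flip y k $ i \<noteq> z $ i}"
    using assms by (auto simp: flip_nth)
  then show ?thesis
    using \<open>flip y k $ k = z $ k\<close> by (simp add: hamming_def)
qed

lemma hamming_flip_agree:
  assumes "y $ k = z $ k"
  shows "hamming (flip y k) z = Suc (hamming y z)"
proof -
  have "{i. flip y k $ i \<noteq> z $ i} = insert k {i. y $ i \<noteq> z $ i}"
    using assms by (auto simp: flip_nth)
  then show ?thesis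
    using assms by (simp add: hamming_def)
qed

lemma hamming_eq_0_iff: "hamming y z = 0 \<longleftrightarrow> y = z"
  by (simp add: hamming_def vec_eq_iff)

lemma hamming_le_card: "hamming (y :: 2 ^ 'd::finite) z \<le> CARD('d)"
  unfolding hamming_def by (intro card_mono) auto

lemma card_agree:
  "card {k. (y :: 2 ^ 'd::finite) $ k = z $ k} = CARD('d) - hamming y z"
proof -
  have "{k. y $ k = z $ k} = UNIV - {k. y $ k \<noteq> z $ k}"
    by auto
  then show ?thesis
    by (simp add: hamming_def card_Diff_subset)
qed

lemma cube_adj_iff_hamming: "cube_adj y z \<longleftrightarrow> hamming y z = 1"
  unfolding cube_adj_def hamming_def One_nat_def card_1_singleton_iff set_eq_iff mem_Collect_eq
    singleton_iff
  by metis

text \<open>One step along an edge lowers the Hamming distance to \<open>z\<close> by at most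
  1.\<close>

lemma hamming_le_relpowp: "(cube_adj ^^ n) y z \<Longrightarrow> hamming y z \<le> n"
proof (induction n arbitrary: y)
  case 0
  then show ?case
    by (simp add: hamming_eq_0_iff)
next
  case (Suc n)
  then obtain k where "(cube_adj ^^ n) (flip y k) z"
    by (metis cube_adj_iff_flip rangeE relpowp_Suc_D2)
  then have "hamming (flip y k) z \<le> n"
    by (rule Suc.IH)
  then show ?case
    using hamming_flip_differ[of y k z] hamming_flip_agree[of y k z]
    by (cases "y $ k = z $ k") auto
qed

text \<open>Flipping the differing coordinates one at a time gives a walk of exactly this
  length.\<close>

lemma relpowp_hamming: "(cube_adj ^^ hamming y z) y z"
proof (induction "hamming y z" arbitrary: y)
  case 0
  then show ?case
    by (metis hamming_eq_0_iff relpowp_0_I)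
next
  case (Suc n)
  then have "y \<noteq> z"
    by (metis hamming_eq_0_iff nat.distinct(1))
  then obtain k where "y $ k \<noteq> z $ k"
    by (auto simp: vec_eq_iff)
  then have step: "hamming y z = Suc (hamming (flip y k) z)"
    by (rule hamming_flip_differ)
  then have "(cube_adj ^^ hamming (flip y k) z) (flip y k) z"
    using Suc by simp
  moreover have "cube_adj y (flip y k)"
    by (simp add: cube_adj_iff_flip)
  ultimately show ?case
    unfolding step by (rule relpowp_Suc_I2[rotated])
qed

lemma cube_dist_eq_hamming: "cube_dist y z = hamming y z"
  unfolding cube_dist_def
  by (intro Least_equality relpowp_hamming hamming_le_relpowp)

section \<open>Subalgebras of the matrix algebra\<close>

definition diag_matrix :: "('n::finite \<Rightarrow> complex) \<Rightarrow> complex ^ 'n ^ 'n" where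
  "diag_matrix g = (\<chi> y z. if y = z then g y else 0)"

lemma matrix_mult_diag_nth: "(M ** diag_matrix g) $ y $ z = M $ y $ z * g z"
proof -
  have "(M ** diag_matrix g) $ y $ z = (\<Sum>k\<in>UNIV. if k = z then M $ y $ k * g k else 0)"
    unfolding matrix_matrix_mult_def diag_matrix_def vec_lambda_beta by (intro sum.cong) simp_all
  then show ?thesis
    by simp
qed

context
  fixes S :: "(complex ^ 'n::finite ^ 'n) set"
  assumes S: "matrix_subalgebra S"
begin

lemma subalgebra_mat_1: "mat 1 \<in> S"
  and subalgebra_add: "M \<in> S \<Longrightarrow> N \<in> S \<Longrightarrow> M + N \<in> S"
  and subalgebra_scale: "M \<in> S \<Longrightarrow> (\<chi> i j. c * M $ i $ j) \<in> S"
  and subalgebra_mult: "M \<in> S \<Longrightarrow> N \<in> S \<Longrightarrow> M ** N \<in> S"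
  using S unfolding matrix_subalgebra_def by blast+

lemma subalgebra_zero: "0 \<in> S"
proof -
  have "(\<chi> i j. 0 * (mat 1 :: complex ^ 'n ^ 'n) $ i $ j) \<in> S"
    by (rule subalgebra_scale[OF subalgebra_mat_1])
  also have "(\<chi> i j. 0 * (mat 1 :: complex ^ 'n ^ 'n) $ i $ j) = 0"
    by (simp add: vec_eq_iff)
  finally show ?thesis .
qed

lemma subalgebra_sum: "(\<And>a. a \<in> I \<Longrightarrow> F a \<in> S) \<Longrightarrow> sum F I \<in> S"
  by (induction I rule: infinite_finite_induct) (auto intro: subalgebra_zero subalgebra_add)

text \<open>A constant diagonal is a scalar multiple of \<open>mat 1\<close>. Such matrices supply
  the empty sums and products as well as the coefficients in the interpolation below.\<close>

lemma subalgebra_diag_const: "diag_matrix (\<lambda>_. c) \<in> S"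
proof -
  have "(\<chi> i j. c * (mat 1 :: complex ^ 'n ^ 'n) $ i $ j) = diag_matrix (\<lambda>_. c)"
    by (simp add: vec_eq_iff mat_def diag_matrix_def)
  then show ?thesis
    using subalgebra_scale[OF subalgebra_mat_1, of c] by simp
qed

lemma subalgebra_diag_add:
  assumes "diag_matrix f \<in> S" "diag_matrix g \<in> S"
  shows "diag_matrix (\<lambda>y. f y + g y) \<in> S"
proof -
  have "diag_matrix f + diag_matrix g = diag_matrix (\<lambda>y. f y + g y)"
    by (simp add: vec_eq_iff diag_matrix_def)
  then show ?thesis
    using subalgebra_add[OF assms] by simp
qed

lemma subalgebra_diag_mult:
  assumes "diag_matrix f \<in> S" "diag_matrix g \<in> S"
  shows "diag_matrix (\<lambda>y. f y * g y) \<in> S"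
proof -
  have "diag_matrix f ** diag_matrix g = diag_matrix (\<lambda>y. f y * g y)"
    by (simp add: vec_eq_iff matrix_mult_diag_nth) (simp add: diag_matrix_def)
  then show ?thesis
    using subalgebra_mult[OF assms] by simp
qed

lemma subalgebra_diag_sum:
  "(\<And>a. a \<in> I \<Longrightarrow> diag_matrix (F a) \<in> S) \<Longrightarrow> diag_matrix (\<lambda>y. \<Sum>a\<in>I. F a y) \<in> S"
  by (induction I rule: infinite_finite_induct)
    (auto intro: subalgebra_diag_const subalgebra_diag_add)

lemma subalgebra_diag_prod:
  "(\<And>a. a \<in> I \<Longrightarrow> diag_matrix (F a) \<in> S) \<Longrightarrow> diag_matrix (\<lambda>y. \<Prod>a\<in>I. F a y) \<in> S"
  by (induction I rule: infinite_finite_induct)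
    (auto intro: subalgebra_diag_const subalgebra_diag_mult)

text \<open>Lagrange interpolation at the finitely many diagonal entries.\<close>

lemma subalgebra_diag_comp:
  assumes g: "diag_matrix g \<in> S"
  shows "diag_matrix (\<lambda>y. f (g y)) \<in> S"
proof -
  \<comment> \<open>The Lagrange basis function of the node \<open>c\<close>, evaluated at
    \<open>g y\<close>. It is written with \<open>+\<close>, \<open>*\<close> and constants only, so
    that the closure rules apply to it directly.\<close>
  let ?L = "\<lambda>c y. \<Prod>v\<in>range g - {c}. (g y + (- v)) * inverse (c - v)"
  have L: "?L c y = (if c = g y then 1 else 0)" for c y
  proof (cases "c = g y")
    case True
    have "(g y + - v) * inverse (c - v) = 1" if "v \<in> range g - {c}" for v
    proof -
      have "g y - v \<noteq> 0"
        using that True by auto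
      then show ?thesis
        by (simp add: True)
    qed
    then have "?L c y = 1"
      by (intro prod.neutral ballI)
    with True show ?thesis
      by simp
  next
    case False
    then have "g y \<in> range g - {c}"
      by simp
    then have "?L c y = 0"
      by (intro prod_zero bexI[of _ "g y"]) simp_all
    then show ?thesis
      using False by simp
  qed
  have "(\<Sum>c\<in>range g. f c * ?L c y) = f (g y)" for y
  proof -
    have "(\<Sum>c\<in>range g. f c * ?L c y) = (\<Sum>c\<in>range g. if c = g y then f c else 0)"
      unfolding L by (intro sum.cong) simp_all
    then show ?thesis
      by simp
  qed
  moreover have "diag_matrix (\<lambda>y. \<Sum>c\<in>range g. f c * ?L c y) \<in> S"
    by (intro subalgebra_diag_sum subalgebra_diag_mult subalgebra_diag_prod
        subalgebra_diag_add subalgebra_diag_const g)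
  ultimately show ?thesis
    by simp
qed

end

section \<open>Distance matrices of the cube\<close>

definition distance_matrix :: "nat \<Rightarrow> complex ^ (2 ^ 'd::finite) ^ (2 ^ 'd)" where
  "distance_matrix j = (\<chi> y z. if hamming y z = j then 1 else 0)"

lemma distance_matrix_0: "distance_matrix 0 = mat 1"
  by (simp add: distance_matrix_def mat_def vec_eq_iff hamming_eq_0_iff)

lemma distance_matrix_1: "distance_matrix 1 = cube_adjacency_matrix"
  by (simp add: distance_matrix_def cube_adjacency_matrix_def cube_adj_iff_hamming)

text \<open>The entry counts the neighbours of \<open>y\<close> at distance \<open>j + 1\<close>
  from \<open>z\<close>. If \<open>y\<close> is at distance \<open>j\<close>, these are the flips of
  agreeing coordinates; if at distance \<open>j + 2\<close>, the flips of differing ones; otherwise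
  there are none.\<close>

lemma adjacency_mult_distance_matrix_nth:
  "((cube_adjacency_matrix :: complex ^ (2 ^ 'd::finite) ^ (2 ^ 'd)) ** distance_matrix (Suc j))
     $ y $ z =
   of_nat (j + 2) * distance_matrix (j + 2) $ y $ z +
   (of_nat CARD('d) - of_nat j) * distance_matrix j $ y $ z"
proof -
  let ?h = "hamming y z"
  have "(cube_adjacency_matrix ** distance_matrix (Suc j)) $ y $ z =
      (\<Sum>u\<in>UNIV. if cube_adj y u then if hamming u z = Suc j then 1 else 0 else (0::complex))"
    unfolding matrix_matrix_mult_def cube_adjacency_matrix_def distance_matrix_def
    by (simp, intro sum.cong) simp_all
  also have "\<dots> = (\<Sum>k\<in>UNIV. if hamming (flip y k) z = Suc j then 1 else 0)"
    by (rule sum_cube_adj)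
  also have "\<dots> = (\<Sum>k\<in>UNIV. if y $ k = z $ k then if ?h = j then 1 else 0
      else if ?h = j + 2 then 1 else 0)"
    by (intro sum.cong refl) (auto simp: hamming_flip_agree hamming_flip_differ)
  also have "\<dots> = of_nat (CARD('d) - ?h) * (if ?h = j then 1 else 0) +
      of_nat ?h * (if ?h = j + 2 then 1 else 0)"
  proof -
    have "- {k. y $ k = z $ k} = {k. y $ k \<noteq> z $ k}"
      by auto
    then show ?thesis
      by (subst sum.If_cases)
        (simp_all only: finite Int_UNIV_left sum_constant card_agree hamming_def[symmetric])
  qed
  \<comment> \<open>Since \<open>?h\<close> is at most \<open>CARD('d)\<close>, the difference of
    naturals is not truncated and agrees with the complex one.\<close>
  finally show ?thesis
    using hamming_le_card[of y z] by (auto simp: distance_matrix_def of_nat_diff)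
qed

lemma distance_matrix_in_subalgebra:
  fixes S :: "(complex ^ (2 ^ 'd::finite) ^ (2 ^ 'd)) set"
  assumes S: "matrix_subalgebra S" and A: "cube_adjacency_matrix \<in> S"
  shows "distance_matrix j \<in> S"
proof -
  \<comment> \<open>The recurrence reaches back two indices, so the induction carries two
    consecutive matrices.\<close>
  have "distance_matrix j \<in> S \<and> distance_matrix (Suc j) \<in> S"
  proof (induction j)
    case 0
    then show ?case
      using A subalgebra_mat_1[OF S] by (simp add: distance_matrix_0 distance_matrix_1[simplified])
  next
    case (Suc j)
    let ?B = "cube_adjacency_matrix ** distance_matrix (Suc j) ::
        complex ^ (2 ^ 'd) ^ (2 ^ 'd)"
    \<comment> \<open>Adding \<open>?C\<close> cancels the term in \<open>distance_matrix j\<close>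
      and leaves \<open>j + 2\<close> times the next distance matrix.\<close>
    let ?C = "\<chi> y z. (of_nat j - of_nat CARD('d)) * distance_matrix j $ y $ z ::
        complex ^ (2 ^ 'd) ^ (2 ^ 'd)"
    have "?B + ?C \<in> S"
      using Suc by (intro subalgebra_add[OF S] subalgebra_mult[OF S] subalgebra_scale[OF S] A) auto
    then have "(\<chi> y z. inverse (of_nat (j + 2)) * (?B + ?C) $ y $ z) \<in> S"
      by (rule subalgebra_scale[OF S])
    also have "(\<chi> y z. inverse (of_nat (j + 2)) * (?B + ?C) $ y $ z) =
        distance_matrix (Suc (Suc j))"
    proof -
      have "of_nat (j + 2) \<noteq> (0::complex)"
        by (metis add_2_eq_Suc' nat.distinct(1) of_nat_eq_0_iff)
      then show ?thesis
        unfolding vec_eq_iff vector_add_component adjacency_mult_distance_matrix_nth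
        by (simp add: algebra_simps del: of_nat_add of_nat_Suc)
    qed
    finally show ?case
      using Suc by simp
  qed
  then show ?thesis ..
qed

lemma cube_dual_adjacency_matrix_eq_diag:
  "cube_dual_adjacency_matrix x =
    diag_matrix (\<lambda>y :: 2 ^ 'd::finite. of_nat CARD('d) - 2 * of_nat (hamming x y))"
  by (simp add: cube_dual_adjacency_matrix_def diag_matrix_def cube_dist_eq_hamming vec_eq_iff)

text \<open>The map from \<open>n\<close> to \<open>D - 2 * n\<close> is injective, so the distance
  to \<open>x\<close>, and hence any function of it, is a function of the diagonal entry;
  interpolation then applies.\<close>

lemma diag_hamming_in_subalgebra:
  fixes S :: "(complex ^ (2 ^ 'd::finite) ^ (2 ^ 'd)) set"
  assumes S: "matrix_subalgebra S" and A: "cube_dual_adjacency_matrix x \<in> S"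
  shows "diag_matrix (\<lambda>y. f (hamming x y)) \<in> S"
proof -
  define q :: "nat \<Rightarrow> complex" where "q n = of_nat CARD('d) - 2 * of_nat n" for n
  have "inj q"
    by (auto simp: inj_def q_def)
  moreover have "diag_matrix (\<lambda>y. q (hamming x y)) \<in> S"
    using A unfolding cube_dual_adjacency_matrix_eq_diag q_def .
  then have "diag_matrix (\<lambda>y. f (inv q (q (hamming x y)))) \<in> S"
    by (rule subalgebra_diag_comp[OF S])
  ultimately show ?thesis
    by simp
qed

section \<open>The factorization of \<open>P\<close>\<close>

text \<open>The first factor is the entry of \<open>I - \<i> X\<close>, the second the diagonal
  entry of column \<open>b\<close>. Both are phrased as inequality tests, so that products over
  coordinates become powers of Hamming distances.\<close>

lemma P1_nth: "P1 $ a $ b = (if a \<noteq> b then - \<i> else 1) * (if 0 \<noteq> b then \<i> else 1)"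
  using bit_cases[of a] bit_cases[of b] by (auto simp: P1_def)

text \<open>Only the term with \<open>j = hamming y z\<close> survives at this entry, and it is in
  range because no distance exceeds \<open>CARD('d)\<close>.\<close>

lemma sum_distance_matrix_nth:
  "(\<Sum>j\<le>CARD('d). \<chi> y z. c ^ j * distance_matrix j $ y $ z) $ y $ z =
    c ^ hamming (y :: 2 ^ 'd::finite) z"
proof -
  have "(\<Sum>j\<le>CARD('d). \<chi> y z. c ^ j * distance_matrix j $ y $ z) $ y $ z =
      (\<Sum>j\<le>CARD('d). if hamming y z = j then c ^ j else 0)"
    unfolding sum_component vec_lambda_beta distance_matrix_def by (intro sum.cong) simp_all
  then show ?thesis
    using hamming_le_card[of y z] by simp
qed

lemma cube_P_factorization:
  "(cube_P :: complex ^ (2 ^ 'd::finite) ^ (2 ^ 'd)) =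
    (\<Sum>j\<le>CARD('d). \<chi> y z. (- \<i>) ^ j * distance_matrix j $ y $ z) **
    diag_matrix (\<lambda>z. \<i> ^ hamming 0 z)"
proof -
  have "cube_P $ y $ z = (- \<i>) ^ hamming y z * \<i> ^ hamming 0 z" for y z :: "2 ^ 'd"
    by (simp add: cube_P_def P1_nth prod.distrib prod_if_one_eq_power_card hamming_def)
  then show ?thesis
    unfolding vec_eq_iff matrix_mult_diag_nth sum_distance_matrix_nth by blast
qed

theorem lemma7p2:
  shows "(cube_P :: complex ^ (2 ^ 'd::finite) ^ (2 ^ 'd)) \<in> cube_terwilliger_algebra 0"
  unfolding cube_terwilliger_algebra_def hull_def
proof (rule InterI, clarify)
  fix S :: "(complex ^ (2 ^ 'd) ^ (2 ^ 'd)) set"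
  assume S: "matrix_subalgebra S"
    and gens: "{cube_adjacency_matrix, cube_dual_adjacency_matrix 0} \<subseteq> S"
  show "cube_P \<in> S"
    \<comment> \<open>The first factor is generated by the adjacency matrix alone, the second by the
      dual adjacency matrix alone.\<close>
    unfolding cube_P_factorization using gens
    by (intro subalgebra_mult[OF S] subalgebra_sum[OF S] subalgebra_scale[OF S]
        distance_matrix_in_subalgebra[OF S] diag_hamming_in_subalgebra[OF S]) auto
qed

end
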